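(* Let $(X,\Sigma)$ be a measurable space, let $\mu$ be a probability measure on $(X^\infty,\Sigma^\infty)$ and let $\mathcal{P}$ be a partition of $X$. Let $\mathfrak{S}:X^\infty\to X^\infty$ be the shift $(x_0,x_1,x_2,\ldots)\mapsto(x_1,x_2,\ldots)$ and $\mathfrak{S}_*\mu$ the push-forward of $\mu$ under $\mathfrak{S}$. Then $$H^{ip}(\mathfrak{S}_*\mu,\mathcal{P})=H^{ip}(\mu,\mathcal{P}).$$ Consequently $H^{ip}(\mathfrak{S}_*\mu)=H^{ip}(\mu)$.
   Context: Let $(X,\Sigma)$ be a measurable space; $X^\infty=\prod_{n=0}^\infty X$ carries the product $\sigma$-algebra $\Sigma^\infty$. A partition of a measurable space is a finite collection of pairwise disjoint measurable sets whose union is the whole space. For a probability measure $\nu$ and a partition $\mathcal{P}=\{A_i\}_{i=1}^k$, the Shannon entropy is $H^{sh}(\nu,\mathcal{P})=-\sum_{i=1}^k\nu(A_i)\log\nu(A_i)$ (with $0\log 0=0$). For $A_0,\ldots,A_{n-1}\in\Sigma$ put $\overline{A_0\cdots A_{n-1}}=A_0\times\cdots\times A_{n-1}\times X\times X\times\cdots\subseteq X^\infty$; for a partition $\mathcal{P}=\{A_i\}_{i\in I}$ of $X$ let $\overline{\mathcal{P}}^n=\{\overline{A_{i_0}\cdots A_{i_{n-1}}}:i_0,\ldots,i_{n-1}\in I\}$, a partition of $X^\infty$. For a probability measure $\mu$ on $(X^\infty,\Sigma^\infty)$, the infinite-product entropy is defined by $H^{ip}(\mu,\mathcal{P})=\limsup_{n\to\infty}\frac1n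 H^{sh}(\mu,\overline{\mathcal{P}}^n)$ and $H^{ip}(\mu)=\sup_{\mathcal{P}}H^{ip}(\mu,\mathcal{P})\in[0,\infty]$, the supremum over all partitions $\mathcal{P}$ of $X$. *)

theory Defs
  imports "HOL-Probability.Probability"
begin

text \<open>
  A measurable space \<open>(X, \<Sigma>)\<close> is represented by \<open>M :: 'a measure\<close>, of which only
  \<^term>\<open>space M\<close> and \<^term>\<open>sets M\<close> are used.
\<close>

abbreviation seq_space :: "'a measure \<Rightarrow> (nat \<Rightarrow> 'a) measure"
  where "seq_space M \<equiv> (\<Pi>\<^sub>M i\<in>UNIV. M)"

text \<open>Unlike for \<^const>\<open>partition_on\<close>, the empty set is allowed as a part.\<close>

definition measurable_partition :: "'a measure \<Rightarrow> 'a set set \<Rightarrow> bool"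
  where "measurable_partition M P \<longleftrightarrow>
    finite P \<and> P \<subseteq> sets M \<and> disjoint P \<and> \<Union>P = space M"

text \<open>Since \<^prop>\<open>ln (0::real) = 0\<close>, the convention \<open>0 log 0 = 0\<close> holds; logarithms are natural.\<close>

definition shannon_entropy :: "'a measure \<Rightarrow> 'a set set \<Rightarrow> real"
  where "shannon_entropy N P = - (\<Sum>A\<in>P. measure N A * ln (measure N A))"

definition cylinder :: "'a measure \<Rightarrow> nat \<Rightarrow> (nat \<Rightarrow> 'a set) \<Rightarrow> (nat \<Rightarrow> 'a) set"
  where "cylinder M n A = (\<Pi>\<^sub>E i\<in>UNIV. if i < n then A i else space M)"

definition cylinder_partition :: "'a measure \<Rightarrow> 'a set set \<Rightarrow> nat \<Rightarrow> (nat \<Rightarrow> 'a) set set"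
  where "cylinder_partition M P n = {cylinder M n A |A. \<forall>i<n. A i \<in> P}"

definition ip_entropy_wrt :: "'a measure \<Rightarrow> (nat \<Rightarrow> 'a) measure \<Rightarrow> 'a set set \<Rightarrow> ereal"
  where "ip_entropy_wrt M \<mu> P =
    limsup (\<lambda>n. ereal (1 / real n * shannon_entropy \<mu> (cylinder_partition M P n)))"

definition ip_entropy :: "'a measure \<Rightarrow> (nat \<Rightarrow> 'a) measure \<Rightarrow> ereal"
  where "ip_entropy M \<mu> = (SUP P\<in>{P. measurable_partition M P}. ip_entropy_wrt M \<mu> P)"

definition seq_shift :: "(nat \<Rightarrow> 'a) \<Rightarrow> nat \<Rightarrow> 'a"
  where "seq_shift x = (\<lambda>n. x (Suc n))"

text \<open>
  The push-forward along \<^const>\<open>seq_shift\<close> is taken with \<^const>\<open>distr\<close>, which is meaningful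
  only for measurable maps.
\<close>

lemma measurable_seq_shift [measurable]: "seq_shift \<in> seq_space M \<rightarrow>\<^sub>M seq_space M"
  unfolding seq_shift_def
  by (rule measurable_PiM_single') (auto simp: space_PiM PiE_iff)

end

theory Submission
  imports Defs
begin

text \<open>
  The partition \<open>\<P>\<^sup>n\<^sup>+\<^sup>1\<close> is the join of the pull-back of \<open>\<P>\<^sup>n\<close> under the shift with the partition of the
  sequences according to their first entry. The former has the same entropy under \<open>\<mu>\<close> as \<open>\<P>\<^sup>n\<close> has
  under the push-forward of \<open>\<mu>\<close>, and the latter has at most \<open>|\<P>|\<close> parts, so the join changes the
  entropy by an amount between \<open>0\<close> and \<open>log |\<P>|\<close>, which is negligible after division by \<open>n\<close>.
\<close>

section \<open>Entropy of a mass split into finitely many pieces\<close>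

text \<open>Each \<open>p i\<close> is at most the total, \<open>ln\<close> is monotone on positive
  reals, and terms with \<open>p i = 0\<close> vanish. With signs reversed: splitting a mass does
  not lower its entropy.\<close>

lemma sum_ln_le_sum_ln_sum:
  fixes p :: "'b \<Rightarrow> real"
  assumes "finite I" and "\<And>i. i \<in> I \<Longrightarrow> 0 \<le> p i"
  shows "(\<Sum>i\<in>I. p i * ln (p i)) \<le> (\<Sum>i\<in>I. p i) * ln (\<Sum>i\<in>I. p i)"
proof -
  have "p i * ln (p i) \<le> p i * ln (sum p I)" if "i \<in> I" for i
  proof (cases "p i = 0")
    case False
    moreover have "p i \<le> sum p I"
      using assms that by (intro member_le_sum) auto
    ultimately show ?thesis
      using assms(2)[OF that] by (intro mult_left_mono) auto
  qed simp
  then show ?thesis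
    unfolding sum_distrib_right by (rule sum_mono)
qed

text \<open>Gibbs' inequality against the uniform split: cutting a mass s into k pieces raises its
  entropy by at most s ln k. The total is arbitrary because it will be the mass of a single
  cylinder.\<close>

lemma sum_ln_sum_le:
  fixes p :: "'b \<Rightarrow> real"
  assumes "finite I" and "I \<noteq> {}" and "\<And>i. i \<in> I \<Longrightarrow> 0 \<le> p i"
  shows "(\<Sum>i\<in>I. p i) * ln (\<Sum>i\<in>I. p i) - (\<Sum>i\<in>I. p i) * ln (real (card I))
    \<le> (\<Sum>i\<in>I. p i * ln (p i))"
proof -
  define s where "s = sum p I"
  define k where "k = real (card I)"
  have k: "k > 0"
    using assms by (simp add: k_def card_gt_0_iff)
  \<comment> \<open>For \<open>p i > 0\<close> this is ln t \<le> t - 1 at t = s / (k * p i), the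
    ratio of the uniform share to the actual one. The right-hand sides sum to zero.\<close>
  have "p i * ln s - p i * ln k - p i * ln (p i) \<le> s / k - p i" if "i \<in> I" for i
  proof (cases "p i = 0")
    case True
    then show ?thesis
      using k assms by (simp add: s_def sum_nonneg)
  next
    case False
    then have p: "p i > 0"
      using assms(3)[OF that] by simp
    moreover have "p i \<le> s"
      unfolding s_def using assms that by (intro member_le_sum) auto
    ultimately have s: "s > 0" by simp
    have "p i * ln s - p i * ln k - p i * ln (p i) = p i * ln (s / (k * p i))"
      using p s k by (simp add: ln_div ln_mult algebra_simps)
    also have "\<dots> \<le> p i * (s / (k * p i) - 1)"
      using p s k by (intro mult_left_mono ln_le_minus_one) auto
    also have "\<dots> = s / k - p i"
      using p k by (simp add: field_simps)
    finally show ?thesis .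
  qed
  then have "(\<Sum>i\<in>I. p i * ln s - p i * ln k - p i * ln (p i)) \<le> (\<Sum>i\<in>I. s / k - p i)"
    by (rule sum_mono)
  also have "\<dots> = 0"
    using k by (simp add: sum_subtractf s_def k_def)
  finally show ?thesis
    by (simp add: sum_subtractf s_def k_def flip: sum_distrib_right)
qed

section \<open>Cylinders split at the first coordinate\<close>

definition cons_set :: "'a measure \<Rightarrow> 'a set \<Rightarrow> (nat \<Rightarrow> 'a) set \<Rightarrow> (nat \<Rightarrow> 'a) set"
  where "cons_set M B C = {x \<in> space (seq_space M). x 0 \<in> B \<and> seq_shift x \<in> C}"

lemma space_seq_space: "x \<in> space (seq_space M) \<longleftrightarrow> (\<forall>i. x i \<in> space M)"
  by (auto simp: space_PiM PiE_iff)

lemma mem_cylinder: "x \<in> cylinder M n A \<longleftrightarrow> (\<forall>i. if i < n then x i \<in> A i else x i \<in> space M)"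
  by (auto simp: cylinder_def PiE_iff split: if_splits)

lemma sets_cons_set:
  assumes "B \<in> sets M" and "C \<in> sets (seq_space M)"
  shows "cons_set M B C \<in> sets (seq_space M)"
  using assms unfolding cons_set_def by measurable

text \<open>Separating index 0 from the successors peels off the first factor. The inclusions
  \<open>A i \<subseteq> space M\<close> put the cylinder inside the sequence space, as
  \<open>cons_set\<close> demands.\<close>

lemma cylinder_Suc:
  assumes "\<And>i. i < Suc n \<Longrightarrow> A i \<subseteq> space M"
  shows "cylinder M (Suc n) A = cons_set M (A 0) (cylinder M n (\<lambda>i. A (Suc i)))"
    (is "?L = ?R")
proof (rule set_eqI)
  fix x
  have split: "(\<forall>i. Q i) \<longleftrightarrow> Q 0 \<and> (\<forall>i. Q (Suc i))" for Q :: "nat \<Rightarrow> bool"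
    by (metis nat.exhaust)
  have "x \<in> ?L \<longleftrightarrow> x 0 \<in> A 0 \<and> seq_shift x \<in> cylinder M n (\<lambda>i. A (Suc i))"
    unfolding mem_cylinder seq_shift_def by (subst split) simp
  moreover have "x \<in> space (seq_space M)" if "x \<in> ?L"
    using that assms unfolding mem_cylinder space_seq_space by (metis subsetD)
  ultimately show "x \<in> ?L \<longleftrightarrow> x \<in> ?R"
    by (auto simp: cons_set_def)
qed

lemma cylinder_partition_0: "cylinder_partition M P 0 = {space (seq_space M)}"
  by (auto simp: cylinder_partition_def cylinder_def space_PiM)

lemma cylinder_partition_Suc:
  assumes "measurable_partition M P"
  shows "cylinder_partition M P (Suc n)
    = (\<lambda>(B, C). cons_set M B C) ` (P \<times> cylinder_partition M P n)"
proof (intro set_eqI iffI)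
  have sub: "B \<subseteq> space M" if "B \<in> P" for B
    using assms that by (auto simp: measurable_partition_def)
  fix D
  {
    assume "D \<in> cylinder_partition M P (Suc n)"
    then obtain A where A: "D = cylinder M (Suc n) A" "\<forall>i<Suc n. A i \<in> P"
      by (auto simp: cylinder_partition_def)
    have "cylinder M n (\<lambda>i. A (Suc i)) \<in> cylinder_partition M P n"
      using A by (auto simp: cylinder_partition_def)
    then show "D \<in> (\<lambda>(B, C). cons_set M B C) ` (P \<times> cylinder_partition M P n)"
      using A sub by (auto simp: cylinder_Suc intro!: image_eqI[where x = "(A 0, _)"])
  }
  assume "D \<in> (\<lambda>(B, C). cons_set M B C) ` (P \<times> cylinder_partition M P n)"
  then obtain B A where A: "B \<in> P" "\<forall>i<n. A i \<in> P" "D = cons_set M B (cylinder M n A)"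
    by (auto simp: cylinder_partition_def)
  have P: "\<forall>i<Suc n. case_nat B A i \<in> P"
    using A by (auto split: nat.split)
  then have "D = cylinder M (Suc n) (case_nat B A)"
    using cylinder_Suc[of n "case_nat B A" M] sub A by simp
  with P show "D \<in> cylinder_partition M P (Suc n)"
    unfolding cylinder_partition_def by blast
qed

text \<open>By induction, a sequence is located by its head in P and its shift in the shorter
  partition; two different pairs have disjoint heads or disjoint tails.\<close>

lemma measurable_partition_cylinder:
  assumes "measurable_partition M P"
  shows "measurable_partition (seq_space M) (cylinder_partition M P n)"
proof (induction n)
  case 0
  show ?case
    by (simp add: cylinder_partition_0 measurable_partition_def disjoint_def)
next
  case (Suc n)
  let ?C = "cylinder_partition M P n"
  have "\<Union>(cylinder_partition M P (Suc n)) = space (seq_space M)"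
  proof (intro set_eqI iffI)
    fix x assume x: "x \<in> space (seq_space M)"
    then have "x 0 \<in> \<Union>P" "seq_shift x \<in> \<Union>?C"
      using assms Suc measurable_space[OF measurable_seq_shift x]
      by (auto simp: measurable_partition_def space_seq_space)
    then show "x \<in> \<Union>(cylinder_partition M P (Suc n))"
      using x by (auto simp: cylinder_partition_Suc[OF assms] cons_set_def)
  qed (auto simp: cylinder_partition_Suc[OF assms] cons_set_def)
  moreover have "disjoint (cylinder_partition M P (Suc n))"
    unfolding cylinder_partition_Suc[OF assms]
  proof (rule disjointI)
    fix D E assume *: "D \<in> (\<lambda>(B, C). cons_set M B C) ` (P \<times> ?C)"
      "E \<in> (\<lambda>(B, C). cons_set M B C) ` (P \<times> ?C)" "D \<noteq> E"
    then obtain B C B' C' where "B \<in> P" "B' \<in> P" "C \<in> ?C" "C' \<in> ?C"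
      "D = cons_set M B C" "E = cons_set M B' C'" "B \<noteq> B' \<or> C \<noteq> C'"
      by auto
    moreover from this have "B \<inter> B' = {} \<or> C \<inter> C' = {}"
      using assms Suc by (auto simp: measurable_partition_def dest: disjointD)
    ultimately show "D \<inter> E = {}"
      by (auto simp: cons_set_def)
  qed
  ultimately show ?case
    using assms Suc
    by (auto simp: measurable_partition_def cylinder_partition_Suc[OF assms]
      intro!: sets_cons_set)
qed

section \<open>Masses and entropies under the push-forward\<close>

lemma (in prob_space) sum_prob_partition:
  assumes "measurable_partition M Q"
  shows "(\<Sum>A\<in>Q. prob A) = 1"
proof -
  have "(\<Sum>A\<in>Q. prob A) = prob (\<Union>A\<in>Q. A)"
    using assms by (intro finite_measure_finite_Union[symmetric])
      (auto simp: measurable_partition_def disjoint_family_on_def disjoint_def)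
  also have "(\<Union>A\<in>Q. A) = space M"
    using assms by (simp add: measurable_partition_def)
  finally show ?thesis
    by (simp add: prob_space)
qed

lemma shift_measurable:
  assumes "sets \<mu> = sets (seq_space M)"
  shows "seq_shift \<in> \<mu> \<rightarrow>\<^sub>M seq_space M"
  using measurable_seq_shift measurable_cong_sets[OF assms refl] by blast

lemma prob_space_shift:
  assumes "prob_space \<mu>" and "sets \<mu> = sets (seq_space M)"
  shows "prob_space (distr \<mu> (seq_space M) seq_shift)"
  using assms shift_measurable by (intro prob_space.prob_space_distr)

context
  fixes M :: "'a measure" and \<mu> :: "(nat \<Rightarrow> 'a) measure" and P :: "'a set set"
  assumes prob: "prob_space \<mu>" and sets_\<mu>: "sets \<mu> = sets (seq_space M)"
    and P: "measurable_partition M P"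
begin

interpretation prob_space \<mu>
  by (rule prob)

lemma space_\<mu>: "space \<mu> = space (seq_space M)"
  using sets_\<mu> by (rule sets_eq_imp_space_eq)

lemma partition_nonempty: "P \<noteq> {}"
  using P not_empty by (auto simp: measurable_partition_def space_\<mu> space_seq_space)

text \<open>Grouping by the tail C makes each inner sum a split of one mass into pieces indexed by
  P, the form to which the inequalities on finite sums apply.\<close>

lemma shannon_entropy_cylinder_Suc:
  "shannon_entropy \<mu> (cylinder_partition M P (Suc n))
    = - (\<Sum>C\<in>cylinder_partition M P n. \<Sum>B\<in>P. prob (cons_set M B C) * ln (prob (cons_set M B C)))"
proof -
  let ?C = "cylinder_partition M P n"
  let ?f = "\<lambda>D. prob D * ln (prob D)"
  have C: "finite ?C" "disjoint ?C" and P': "finite P" "disjoint P"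
    using P measurable_partition_cylinder[OF P, of n] by (auto simp: measurable_partition_def)
  \<comment> \<open>Different pairs \<open>(B, C)\<close> yield the same set only if that set is empty.\<close>
  have "sum ?f (cylinder_partition M P (Suc n))
      = sum (?f \<circ> (\<lambda>(B, C). cons_set M B C)) (P \<times> ?C)"
    unfolding cylinder_partition_Suc[OF P]
  proof (rule sum.reindex_nontrivial)
    fix x y assume *: "x \<in> P \<times> ?C" "y \<in> P \<times> ?C" "x \<noteq> y"
      "(case x of (B, C) \<Rightarrow> cons_set M B C) = (case y of (B, C) \<Rightarrow> cons_set M B C)"
    obtain B C B' C' where xy: "x = (B, C)" "y = (B', C')"
      by fastforce
    have "B \<inter> B' = {} \<or> C \<inter> C' = {}"
      using * C P' unfolding xy by (auto dest: disjointD)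
    then have "cons_set M B C \<inter> cons_set M B' C' = {}"
      by (auto simp: cons_set_def)
    then have "cons_set M B C = {}"
      using * unfolding xy by auto
    then show "?f (case x of (B, C) \<Rightarrow> cons_set M B C) = 0"
      by (simp add: xy)
  qed (use C P' in auto)
  also have "\<dots> = (\<Sum>C\<in>?C. \<Sum>B\<in>P. ?f (cons_set M B C))"
    by (subst sum.swap) (simp add: sum.cartesian_product case_prod_beta)
  finally show ?thesis
    by (simp add: shannon_entropy_def)
qed

text \<open>Since P partitions X, the sets \<open>cons_set M B C\<close> with B in P partition the
  preimage of C under the shift.\<close>

lemma sum_prob_cons_set:
  assumes "C \<in> sets (seq_space M)"
  shows "(\<Sum>B\<in>P. prob (cons_set M B C)) = measure (distr \<mu> (seq_space M) seq_shift) C"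
proof -
  let ?S = "seq_shift -` C \<inter> space \<mu>"
  have "\<Union>P = space M" "finite P" "disjoint P" and PM: "\<And>B. B \<in> P \<Longrightarrow> B \<in> sets M"
    using P by (auto simp: measurable_partition_def)
  have "prob ?S = prob (\<Union>B\<in>P. cons_set M B C)"
    by (intro arg_cong[where f = prob])
      (auto simp: cons_set_def space_\<mu> space_seq_space simp flip: \<open>\<Union>P = space M\<close>)
  also have "\<dots> = (\<Sum>B\<in>P. prob (cons_set M B C))"
    using \<open>finite P\<close> \<open>disjoint P\<close> PM assms
    by (intro finite_measure_finite_Union)
      (auto simp: sets_\<mu> disjoint_family_on_def cons_set_def[of _ _ C] disjoint_def
        intro!: sets_cons_set[unfolded cons_set_def])
  finally show ?thesis
    using assms by (simp add: measure_distr[OF shift_measurable[OF sets_\<mu>]])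
qed

lemma shannon_entropy_shift_le:
  "shannon_entropy (distr \<mu> (seq_space M) seq_shift) (cylinder_partition M P n)
    \<le> shannon_entropy \<mu> (cylinder_partition M P (Suc n))"
  (is "shannon_entropy ?\<nu> ?C \<le> _")
proof -
  have C: "C \<in> sets (seq_space M)" if "C \<in> ?C" for C
    using that measurable_partition_cylinder[OF P, of n] by (auto simp: measurable_partition_def)
  have "(\<Sum>B\<in>P. prob (cons_set M B C) * ln (prob (cons_set M B C)))
      \<le> measure ?\<nu> C * ln (measure ?\<nu> C)" if "C \<in> ?C" for C
    using sum_ln_le_sum_ln_sum[of P "\<lambda>B. prob (cons_set M B C)"] P
    by (simp add: sum_prob_cons_set[OF C[OF that]] measurable_partition_def)
  then show ?thesis
    unfolding shannon_entropy_cylinder_Suc unfolding shannon_entropy_def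
    by (simp add: sum_mono)
qed

lemma shannon_entropy_Suc_le:
  "shannon_entropy \<mu> (cylinder_partition M P (Suc n))
    \<le> shannon_entropy (distr \<mu> (seq_space M) seq_shift) (cylinder_partition M P n)
      + ln (real (card P))"
  (is "_ \<le> shannon_entropy ?\<nu> ?C + _")
proof -
  have C: "C \<in> sets (seq_space M)" if "C \<in> ?C" for C
    using that measurable_partition_cylinder[OF P, of n] by (auto simp: measurable_partition_def)
  have "measure ?\<nu> C * ln (measure ?\<nu> C) - measure ?\<nu> C * ln (real (card P))
      \<le> (\<Sum>B\<in>P. prob (cons_set M B C) * ln (prob (cons_set M B C)))" if "C \<in> ?C" for C
    using sum_ln_sum_le[of P "\<lambda>B. prob (cons_set M B C)"] P partition_nonempty
    by (simp add: sum_prob_cons_set[OF C[OF that]] measurable_partition_def)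
  then have "(\<Sum>C\<in>?C. measure ?\<nu> C * ln (measure ?\<nu> C) - measure ?\<nu> C * ln (real (card P)))
      \<le> (\<Sum>C\<in>?C. \<Sum>B\<in>P. prob (cons_set M B C) * ln (prob (cons_set M B C)))"
    by (rule sum_mono)
  \<comment> \<open>The masses of the tails weight the corrections, so these add up to exactly
    \<open>ln (real (card P))\<close>.\<close>
  moreover have "(\<Sum>C\<in>?C. measure ?\<nu> C) = 1"
    using measurable_partition_cylinder[OF P, of n]
    by (intro prob_space.sum_prob_partition prob_space_shift prob sets_\<mu>)
      (simp add: measurable_partition_def)
  ultimately show ?thesis
    unfolding shannon_entropy_cylinder_Suc unfolding shannon_entropy_def
    by (simp add: sum_subtractf flip: sum_distrib_right)
qed

end

section \<open>Linear growth and passage to the limit\<close>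

text \<open>Each further coordinate adds at most \<open>ln (real (card P))\<close>. The induction
  varies \<mu> because its step passes to the push-forward. The bound later controls the change of
  normalisation from 1/n to 1/(n+1).\<close>

lemma shannon_entropy_cylinder_le:
  assumes "prob_space \<mu>" and "sets \<mu> = sets (seq_space M)" and "measurable_partition M P"
  shows "shannon_entropy \<mu> (cylinder_partition M P n) \<le> real n * ln (real (card P))"
  using assms(1,2)
proof (induction n arbitrary: \<mu>)
  case 0
  then have "measure \<mu> (space (seq_space M)) = 1"
    using prob_space.prob_space sets_eq_imp_space_eq by metis
  then show ?case
    by (simp add: cylinder_partition_0 shannon_entropy_def)
next
  case (Suc n)
  have "shannon_entropy (distr \<mu> (seq_space M) seq_shift) (cylinder_partition M P n)
      \<le> real n * ln (real (card P))"
    using prob_space_shift[OF Suc.prems] by (intro Suc.IH) simp_all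
  with shannon_entropy_Suc_le[OF Suc.prems assms(3), of n] show ?case
    by (simp add: algebra_simps)
qed

lemma shannon_entropy_nonneg:
  assumes "prob_space \<nu>"
  shows "0 \<le> shannon_entropy \<nu> Q"
proof -
  interpret prob_space \<nu> by (rule assms)
  have "prob A * ln (prob A) \<le> 0" for A
    by (cases "prob A = 0") (auto intro!: mult_nonneg_nonpos simp: zero_less_measure_iff)
  then show ?thesis
    by (simp add: shannon_entropy_def sum_nonpos)
qed

lemma ip_entropy_wrt_shift:
  assumes \<mu>: "prob_space \<mu>" "sets \<mu> = sets (seq_space M)" and P: "measurable_partition M P"
  shows "ip_entropy_wrt M (distr \<mu> (seq_space M) seq_shift) P = ip_entropy_wrt M \<mu> P"
proof -
  let ?\<nu> = "distr \<mu> (seq_space M) seq_shift"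
  define L where "L = ln (real (card P))"
  define a where "a n = shannon_entropy \<mu> (cylinder_partition M P n)" for n
  define b where "b n = shannon_entropy ?\<nu> (cylinder_partition M P n)" for n
  \<comment> \<open>The indices are offset by one because n coordinates of the shifted sequence come
    from n+1 coordinates of the original.\<close>
  define d where "d n = 1 / real (Suc n) * a (Suc n) - 1 / real n * b n" for n
  have \<nu>: "prob_space ?\<nu>"
    using prob_space_shift[OF \<mu>] .
  have "\<bar>d n\<bar> \<le> L / real (Suc n)" if "n > 0" for n
  proof -
    have b: "0 \<le> b n" "b n \<le> real n * L"
      using shannon_entropy_nonneg[OF \<nu>] shannon_entropy_cylinder_le[OF \<nu> _ P]
      by (auto simp: b_def L_def)
    have ab: "b n \<le> a (Suc n)" "a (Suc n) \<le> b n + L"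
      using shannon_entropy_shift_le[OF \<mu> P] shannon_entropy_Suc_le[OF \<mu> P]
      by (auto simp: a_def b_def L_def)
    have d: "d n = (a (Suc n) - b n - b n / real n) / real (Suc n)"
      using that by (simp add: d_def field_simps)
    have "0 \<le> b n / real n" "b n / real n \<le> L"
      using b that by (auto simp: field_simps)
    \<comment> \<open>Both \<open>a (Suc n) - b n\<close> and \<open>b n / real n\<close> lie
      between 0 and L, hence so does the absolute value of their difference.\<close>
    then have "\<bar>a (Suc n) - b n - b n / real n\<bar> \<le> L"
      using ab by linarith
    then show ?thesis
      by (simp add: d divide_right_mono)
  qed
  then have "eventually (\<lambda>n. norm (d n) \<le> L / real (Suc n)) sequentially"
    by (auto intro: eventually_sequentiallyI[of 1])
  moreover have "(\<lambda>n. L / real (Suc n)) \<longlonglongrightarrow> 0"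
    by (intro LIMSEQ_Suc lim_const_over_n)
  ultimately have "d \<longlonglongrightarrow> 0"
    by (rule Lim_null_comparison)
  then have "(\<lambda>n. ereal (d n)) \<longlonglongrightarrow> 0"
    by (simp add: zero_ereal_def)
  \<comment> \<open>Adding a null sequence leaves the limsup unchanged; the sum is the normalised
    entropy of \<mu> at index n+1, and dropping an initial term does not affect the limsup
    either.\<close>
  then have "limsup (\<lambda>n. ereal (d n) + ereal (1 / real n * b n))
      = 0 + limsup (\<lambda>n. ereal (1 / real n * b n))"
    by (rule ereal_limsup_lim_add) simp
  moreover have "limsup (\<lambda>n. ereal (d n) + ereal (1 / real n * b n))
      = limsup (\<lambda>n. ereal (1 / real n * a n))"
    using limsup_shift[of "\<lambda>n. ereal (1 / real n * a n)"] by (simp add: d_def)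
  ultimately show ?thesis
    by (simp add: ip_entropy_wrt_def a_def b_def)
qed

theorem proposition2p4:
  fixes M :: "'a measure" and \<mu> :: "(nat \<Rightarrow> 'a) measure"
  assumes "prob_space \<mu>" and "sets \<mu> = sets (seq_space M)"
  shows "(\<forall>P. measurable_partition M P \<longrightarrow>
            ip_entropy_wrt M (distr \<mu> (seq_space M) seq_shift) P = ip_entropy_wrt M \<mu> P)
       \<and> ip_entropy M (distr \<mu> (seq_space M) seq_shift) = ip_entropy M \<mu>"
  using ip_entropy_wrt_shift[OF assms] by (auto simp: ip_entropy_def intro!: SUP_cong)

end
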